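(* Consider the single drone delivery scheduling problem (SDSP) in which all profits $p_j$ are nonnegative integers, and let $P=\max_{j}p_j$. There is an algorithm that computes an optimal (maximum-profit feasible) set of deliveries for SDSP in time bounded by a polynomial in $n$ and $P$, i.e., in pseudo-polynomial time.
   Context: An SDSP instance consists of a set of deliveries $\mathcal{N}=\{1,\dots,n\}$ and one drone with battery budget $B>0$. Each delivery $j$ has a closed delivery time interval $I_j=[t_j^L,t_j^R]$, a cost $c_j>0$ and a profit $p_j$. Two deliveries $j\neq k$ are compatible if $I_j\cap I_k=\emptyset$. A set $S\subseteq\mathcal{N}$ is compatible if its elements are pairwise compatible, and feasible if it is compatible and $\mathcal{W}(S)=\sum_{j\in S}c_j\le B$. Its profit is $\mathcal{P}(S)=\sum_{j\in S}p_j$. SDSP asks for a feasible set of maximum profit. *)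

theory Defs
  imports Complex_Main "HOL-Computational_Algebra.Polynomial"
begin

section \<open>The single drone delivery scheduling problem\<close>

record 'p sdsp =
  num :: nat
  budget :: real
  tL :: "nat \<Rightarrow> real"
  tR :: "nat \<Rightarrow> real"
  cost :: "nat \<Rightarrow> real"
  profit :: "nat \<Rightarrow> 'p"

definition deliveries :: "'p sdsp \<Rightarrow> nat set" where
  "deliveries I = {1..num I}"

definition sdsp_instance :: "'p sdsp \<Rightarrow> bool" where
  "sdsp_instance I \<longleftrightarrow>
     budget I > 0 \<and> (\<forall>j\<in>deliveries I. tL I j \<le> tR I j \<and> cost I j > 0)"

definition interval :: "'p sdsp \<Rightarrow> nat \<Rightarrow> real set" where
  "interval I j = {tL I j..tR I j}"

definition compatible :: "'p sdsp \<Rightarrow> nat set \<Rightarrow> bool" where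
  "compatible I S \<longleftrightarrow> pairwise (\<lambda>j k. interval I j \<inter> interval I k = {}) S"

definition total_cost :: "'p sdsp \<Rightarrow> nat set \<Rightarrow> real" where
  "total_cost I S = (\<Sum>j\<in>S. cost I j)"

definition total_profit :: "'p::comm_monoid_add sdsp \<Rightarrow> nat set \<Rightarrow> 'p" where
  "total_profit I S = (\<Sum>j\<in>S. profit I j)"

definition feasible :: "'p sdsp \<Rightarrow> nat set \<Rightarrow> bool" where
  "feasible I S \<longleftrightarrow> S \<subseteq> deliveries I \<and> compatible I S \<and> total_cost I S \<le> budget I"

definition optimal :: "'p::{comm_monoid_add,ord} sdsp \<Rightarrow> nat set \<Rightarrow> bool" where
  "optimal I S \<longleftrightarrow>
     feasible I S \<and> (\<forall>T. feasible I T \<longrightarrow> total_profit I T \<le> total_profit I S)"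

text \<open>Inserting 0 only matters for an instance without deliveries.\<close>

definition max_profit :: "nat sdsp \<Rightarrow> nat" where
  "max_profit I = Max (insert 0 (profit I ` deliveries I))"

section \<open>Algorithms and their running time\<close>

text \<open>
  Algorithms are programs of a random access machine with two unbounded memories, one of
  natural numbers and one of real numbers, both divided into named arrays that are
  addressed by natural numbers; a scalar variable is cell 0 of an array.

  Every operation has unit cost. The only arithmetic operations are addition and
  subtraction (truncated on the natural numbers), the only constants are natural numbers,
  and no operation turns a real number into a natural number. Unit-cost multiplication is
  left out on purpose: by repeated squaring, it would yield numbers of exponential length
  in polynomial time.
\<close>

type_synonym name = string

record state =
  nmem :: "name \<Rightarrow> nat \<Rightarrow> nat"
  rmem :: "name \<Rightarrow> nat \<Rightarrow> real"

datatype nexp =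
    NNum nat
  | NCell name nexp
  | NPlus nexp nexp
  | NMinus nexp nexp

datatype rexp =
    RNum nat
  | RCell name nexp
  | RPlus rexp rexp
  | RMinus rexp rexp

datatype bexp =
    NLess nexp nexp
  | RLess rexp rexp
  | Not bexp
  | And bexp bexp

datatype com =
    Skip
  | NAssign name nexp nexp
  | RAssign name nexp rexp
  | Seq com com
  | If bexp com com
  | While bexp com

fun nval :: "nexp \<Rightarrow> state \<Rightarrow> nat" where
  "nval (NNum k) s = k"
| "nval (NCell x i) s = nmem s x (nval i s)"
| "nval (NPlus a b) s = nval a s + nval b s"
| "nval (NMinus a b) s = nval a s - nval b s"

fun rval :: "rexp \<Rightarrow> state \<Rightarrow> real" where
  "rval (RNum k) s = of_nat k"
| "rval (RCell x i) s = rmem s x (nval i s)"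
| "rval (RPlus a b) s = rval a s + rval b s"
| "rval (RMinus a b) s = rval a s - rval b s"

fun bval :: "bexp \<Rightarrow> state \<Rightarrow> bool" where
  "bval (NLess a b) s \<longleftrightarrow> nval a s < nval b s"
| "bval (RLess a b) s \<longleftrightarrow> rval a s < rval b s"
| "bval (Not b) s \<longleftrightarrow> \<not> bval b s"
| "bval (And a b) s \<longleftrightarrow> bval a s \<and> bval b s"

fun ntime :: "nexp \<Rightarrow> nat" where
  "ntime (NNum k) = 1"
| "ntime (NCell x i) = ntime i + 1"
| "ntime (NPlus a b) = ntime a + ntime b + 1"
| "ntime (NMinus a b) = ntime a + ntime b + 1"

fun rtime :: "rexp \<Rightarrow> nat" where
  "rtime (RNum k) = 1"
| "rtime (RCell x i) = ntime i + 1"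
| "rtime (RPlus a b) = rtime a + rtime b + 1"
| "rtime (RMinus a b) = rtime a + rtime b + 1"

fun btime :: "bexp \<Rightarrow> nat" where
  "btime (NLess a b) = ntime a + ntime b + 1"
| "btime (RLess a b) = rtime a + rtime b + 1"
| "btime (Not b) = btime b + 1"
| "btime (And a b) = btime a + btime b + 1"

definition nstore :: "name \<Rightarrow> nat \<Rightarrow> nat \<Rightarrow> state \<Rightarrow> state" where
  "nstore x i v s = s\<lparr>nmem := (nmem s)(x := (nmem s x)(i := v))\<rparr>"

definition rstore :: "name \<Rightarrow> nat \<Rightarrow> real \<Rightarrow> state \<Rightarrow> state" where
  "rstore x i v s = s\<lparr>rmem := (rmem s)(x := (rmem s x)(i := v))\<rparr>"

text \<open>\<open>exec c s t s'\<close>: started in \<open>s\<close>, the program \<open>c\<close> halts in \<open>s'\<close> after \<open>t\<close> operations.\<close>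

inductive exec :: "com \<Rightarrow> state \<Rightarrow> nat \<Rightarrow> state \<Rightarrow> bool" where
  Skip: "exec Skip s 1 s"
| NAssign: "exec (NAssign x i a) s (ntime i + ntime a + 1) (nstore x (nval i s) (nval a s) s)"
| RAssign: "exec (RAssign x i a) s (ntime i + rtime a + 1) (rstore x (nval i s) (rval a s) s)"
| Seq: "exec c1 s1 t1 s2 \<Longrightarrow> exec c2 s2 t2 s3 \<Longrightarrow> exec (Seq c1 c2) s1 (t1 + t2) s3"
| IfTrue: "bval b s \<Longrightarrow> exec c1 s t s' \<Longrightarrow> exec (If b c1 c2) s (btime b + t) s'"
| IfFalse: "\<not> bval b s \<Longrightarrow> exec c2 s t s' \<Longrightarrow> exec (If b c1 c2) s (btime b + t) s'"
| WhileFalse: "\<not> bval b s \<Longrightarrow> exec (While b c) s (btime b) s"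
| WhileTrue: "bval b s1 \<Longrightarrow> exec c s1 t1 s2 \<Longrightarrow> exec (While b c) s2 t2 s3 \<Longrightarrow>
    exec (While b c) s1 (btime b + t1 + t2) s3"

inductive_cases exec_elims:
  "exec Skip s t s'"
  "exec (NAssign x i a) s t s'"
  "exec (RAssign x i e) s t s'"
  "exec (Seq c1 c2) s t s'"
  "exec (If b c1 c2) s t s'"

inductive_cases exec_WhileE: "exec (While b c) s t s'"

text \<open>
  Programs are deterministic, so that the existence of a terminating run in time \<open>t\<close> is a
  statement about the only run.
\<close>

lemma exec_deterministic:
  "exec c s t s' \<Longrightarrow> exec c s u s'' \<Longrightarrow> t = u \<and> s' = s''"
proof (induction arbitrary: u s'' rule: exec.induct)
  case (Skip s)
  from Skip.prems show ?case by (rule exec_elims) auto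
next
  case (NAssign x i a s)
  from NAssign.prems show ?case by (rule exec_elims) auto
next
  case (RAssign x i a s)
  from RAssign.prems show ?case by (rule exec_elims) auto
next
  case (Seq c1 s1 t1 s2 c2 t2 s3)
  from Seq.prems obtain v1 v2 r where
    "u = v1 + v2" "exec c1 s1 v1 r" "exec c2 r v2 s''"
    by (rule exec_elims)
  with Seq.IH show ?case by blast
next
  case (IfTrue b s c1 t s' c2)
  from IfTrue.prems obtain v where "u = btime b + v" "exec c1 s v s''"
    by (rule exec_elims) (use IfTrue.hyps in auto)
  with IfTrue.IH show ?case by blast
next
  case (IfFalse b s c2 t s' c1)
  from IfFalse.prems obtain v where "u = btime b + v" "exec c2 s v s''"
    by (rule exec_elims) (use IfFalse.hyps in auto)
  with IfFalse.IH show ?case by blast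
next
  case (WhileFalse b s c)
  from WhileFalse.prems show ?case
    by (rule exec_WhileE) (use WhileFalse.hyps in auto)
next
  case (WhileTrue b s1 c t1 s2 t2 s3)
  from WhileTrue.prems obtain v1 v2 r where
    "u = btime b + v1 + v2" "exec c s1 v1 r" "exec (While b c) r v2 s''"
    by (rule exec_WhileE) (use WhileTrue.hyps in auto)
  with WhileTrue.IH show ?case by blast
qed

text \<open>Cells that do not belong to the input are initially 0.\<close>

definition load :: "nat sdsp \<Rightarrow> state" where
  "load I = \<lparr>
     nmem = (\<lambda>x i.
       if x = ''n'' \<and> i = 0 then num I
       else if x = ''p'' \<and> i \<in> deliveries I then profit I i
       else 0),
     rmem = (\<lambda>x i.
       if x = ''B'' \<and> i = 0 then budget I
       else if x = ''tL'' \<and> i \<in> deliveries I then tL I i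
       else if x = ''tR'' \<and> i \<in> deliveries I then tR I i
       else if x = ''c'' \<and> i \<in> deliveries I then cost I i
       else 0)\<rparr>"

text \<open>The computed set is returned as a characteristic array.\<close>

definition result :: "nat sdsp \<Rightarrow> state \<Rightarrow> nat set" where
  "result I s = {j \<in> deliveries I. nmem s ''S'' j \<noteq> 0}"

text \<open>The value of a bivariate polynomial, given as a polynomial over polynomials.\<close>

definition poly2 :: "nat poly poly \<Rightarrow> nat \<Rightarrow> nat \<Rightarrow> nat" where
  "poly2 q x y = poly (poly q [:x:]) y"

end

theory Submission
  imports Defs
begin

text \<open>
  A compatible set is a chain of intervals ordered from left to right. Let \<open>G r j q\<close> be the least
  cost of a chain of at most \<open>r\<close> deliveries with profit exactly \<open>q\<close> that ends before delivery
  \<open>j\<close> starts. Deciding on the last delivery \<open>i\<close> of the chain gives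
  \<open>G r j q = min (c i + G (r - 1) i (q - p i))\<close>, where \<open>i\<close> ranges over the deliveries to the left
  of \<open>j\<close>. Counting the length of chains in a separate index makes it unnecessary to sort the
  deliveries. There are \<open>(n + 1)\<^sup>2 (1 + \<Sum>j. p j)\<close> entries. The optimum is the largest \<open>q\<close> with
  \<open>G n 0 q \<le> B\<close>, where delivery 0 is a dummy to the right of all others, and following the
  minimizers yields the set.
\<close>

section \<open>Weakest preconditions\<close>

text \<open>Runs are unique by \<open>exec_deterministic\<close>, so a claim about some terminating
  run is total correctness, with the running time as an extra argument of \<open>Q\<close>.\<close>

definition wp :: "com \<Rightarrow> (nat \<Rightarrow> state \<Rightarrow> bool) \<Rightarrow> state \<Rightarrow> bool" where
  "wp c Q s \<longleftrightarrow> (\<exists>t s'. exec c s t s' \<and> Q t s')"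

lemma wp_mono: "wp c Q s \<Longrightarrow> (\<And>t s'. Q t s' \<Longrightarrow> Q' t s') \<Longrightarrow> wp c Q' s"
  unfolding wp_def by blast

lemma wp_Skip [simp]: "wp Skip Q s \<longleftrightarrow> Q 1 s"
  unfolding wp_def by (metis exec.Skip exec_deterministic)

lemma wp_NAssign [simp]:
  "wp (NAssign x i a) Q s \<longleftrightarrow> Q (ntime i + ntime a + 1) (nstore x (nval i s) (nval a s) s)"
  unfolding wp_def by (metis exec.NAssign exec_deterministic)

lemma wp_RAssign [simp]:
  "wp (RAssign x i a) Q s \<longleftrightarrow> Q (ntime i + rtime a + 1) (rstore x (nval i s) (rval a s) s)"
  unfolding wp_def by (metis exec.RAssign exec_deterministic)

lemma wp_Seq [simp]:
  "wp (Seq c1 c2) Q s \<longleftrightarrow> wp c1 (\<lambda>t1 s1. wp c2 (\<lambda>t2 s2. Q (t1 + t2) s2) s1) s"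
  unfolding wp_def by (blast intro: exec.Seq elim: exec_elims)

text \<open>Adds upper bounds, so that exact times need not be carried through a
  composition.\<close>

lemma wp_SeqI:
  assumes "wp c1 (\<lambda>t s'. t \<le> T1 \<and> P s') s"
    and "\<And>s'. P s' \<Longrightarrow> wp c2 (\<lambda>t s''. t \<le> T2 \<and> R s'') s'"
  shows "wp (Seq c1 c2) (\<lambda>t s'. t \<le> T1 + T2 \<and> R s') s"
proof -
  have "wp c2 (\<lambda>t2 s''. t1 + t2 \<le> T1 + T2 \<and> R s'') s'" if "t1 \<le> T1 \<and> P s'" for t1 s'
    using that assms(2)[of s'] by (auto elim!: wp_mono)
  then show ?thesis using wp_mono[OF assms(1)] by simp
qed

lemma wp_If [simp]:
  "wp (If b c1 c2) Q s \<longleftrightarrow> wp (if bval b s then c1 else c2) (\<lambda>t. Q (btime b + t)) s"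
  unfolding wp_def by (auto intro: exec.IfTrue exec.IfFalse elim!: exec_elims)

abbreviation V :: "name \<Rightarrow> nexp" where
  "V x \<equiv> NCell x (NNum 0)"

section \<open>Counting loops\<close>

definition For :: "name \<Rightarrow> nexp \<Rightarrow> com \<Rightarrow> com" where
  "For x a c = Seq (NAssign x (NNum 0) (NNum 0))
     (While (NLess (V x) a) (Seq c (NAssign x (NNum 0) (NPlus (V x) (NNum 1)))))"

text \<open>The 9 is 3 for the guard besides \<open>a\<close> plus 6 for the increment; the final 3
  is the initialization. The factor \<open>b + 1\<close> charges the failing last guard as a full
  round.\<close>

definition for_time :: "nat \<Rightarrow> nexp \<Rightarrow> nat \<Rightarrow> nat" where
  "for_time b a T = (b + 1) * (T + ntime a + 9) + 3"

lemma for_time_mono: "b \<le> b' \<Longrightarrow> T \<le> T' \<Longrightarrow> for_time b a T \<le> for_time b' a T'"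
  unfolding for_time_def by (intro add_mono mult_mono) auto

lemma nmem_nstore [simp]:
  "nmem (nstore x i v s) y = (if y = x then (nmem s x)(i := v) else nmem s y)"
  by (simp add: nstore_def)

lemma rmem_nstore [simp]: "rmem (nstore x i v s) = rmem s"
  by (simp add: nstore_def)

lemma rmem_rstore [simp]:
  "rmem (rstore x i v s) y = (if y = x then (rmem s x)(i := v) else rmem s y)"
  by (simp add: rstore_def)

lemma nmem_rstore [simp]: "nmem (rstore x i v s) = nmem s"
  by (simp add: rstore_def)

text \<open>The expression \<open>a\<close> is evaluated anew in every round, hence the invariant
  has to fix its value. The body leaves the counter alone, and the invariant is reestablished only
  after the increment.\<close>

lemma wp_For:
  assumes init: "Inv 0 (nstore x 0 0 s)"
    and bound: "\<And>k s. Inv k s \<Longrightarrow> nval a s = b"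
    and step: "\<And>k s. k < b \<Longrightarrow> nmem s x 0 = k \<Longrightarrow> Inv k s \<Longrightarrow>
      wp c (\<lambda>t s'. t \<le> T \<and> nmem s' x 0 = k \<and> Inv (Suc k) (nstore x 0 (Suc k) s')) s"
    and post: "\<And>t s. t \<le> for_time b a T \<Longrightarrow> Inv b s \<Longrightarrow> Q t s"
  shows "wp (For x a c) Q s"
proof -
  let ?w = "While (NLess (V x) a) (Seq c (NAssign x (NNum 0) (NPlus (V x) (NNum 1))))"
  let ?d = "T + ntime a + 9"
  \<comment> \<open>Induction on the number \<open>m\<close> of remaining rounds.\<close>
  have loop: "\<exists>t s'. exec ?w s t s' \<and> t \<le> (m + 1) * ?d \<and> Inv b s'"
    if "m = b - k" "k \<le> b" "nmem s x 0 = k" "Inv k s" for m k s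
    using that
  proof (induction m arbitrary: k s)
    case 0
    then have "exec ?w s (btime (NLess (V x) a)) s"
      by (intro exec.WhileFalse) (simp add: bound)
    with 0 show ?case by (intro exI conjI) auto
  next
    case (Suc m)
    then have "k < b" by simp
    from step[OF this Suc.prems(3,4)] obtain t s' where
      c: "exec c s t s'" "t \<le> T" "nmem s' x 0 = k" "Inv (Suc k) (nstore x 0 (Suc k) s')"
      unfolding wp_def by blast
    have inc: "exec (NAssign x (NNum 0) (NPlus (V x) (NNum 1))) s' 6 (nstore x 0 (Suc k) s')"
      using exec.NAssign[of x "NNum 0" "NPlus (V x) (NNum 1)" s'] c(3)
      by (simp add: numeral_eq_Suc)
    have m: "m = b - Suc k" using Suc.prems(1) by simp
    have "\<exists>t' s''. exec ?w (nstore x 0 (Suc k) s') t' s'' \<and> t' \<le> (m + 1) * ?d \<and> Inv b s''"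
      using \<open>k < b\<close> by (intro Suc.IH[OF m _ _ c(4)]) auto
    then obtain t' s'' where
      w: "exec ?w (nstore x 0 (Suc k) s') t' s''" "t' \<le> (m + 1) * ?d" "Inv b s''"
      by blast
    have "exec ?w s (btime (NLess (V x) a) + (t + 6) + t') s''"
      using Suc.prems \<open>k < b\<close>
      by (intro exec.WhileTrue[OF _ exec.Seq[OF c(1) inc] w(1)]) (simp add: bound)
    moreover have "btime (NLess (V x) a) + (t + 6) + t' \<le> (Suc m + 1) * ?d"
      using c(2) w(2) by simp
    ultimately show ?case using w(3) by blast
  qed
  obtain t s' where
    w: "exec ?w (nstore x 0 0 s) t s'" "t \<le> (b + 1) * ?d" "Inv b s'"
    using loop[of b 0 "nstore x 0 0 s"] init by auto
  have "exec (NAssign x (NNum 0) (NNum 0)) s 3 (nstore x 0 0 s)"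
    using exec.NAssign[of x "NNum 0" "NNum 0" s] by (simp add: numeral_eq_Suc)
  from exec.Seq[OF this w(1)] have "exec (For x a c) s (3 + t) s'"
    by (simp add: For_def)
  moreover have "Q (3 + t) s'"
    using w(2,3) by (intro post) (auto simp: for_time_def)
  ultimately show ?thesis unfolding wp_def by blast
qed

section \<open>Polynomial bounds\<close>

text \<open>Closure under sums and products yields a polynomial from the shape of a time bound,
  without writing it down.\<close>

definition poly_bounded :: "(nat \<Rightarrow> nat \<Rightarrow> nat) \<Rightarrow> bool" where
  "poly_bounded f \<longleftrightarrow> (\<exists>q. \<forall>x y. f x y \<le> poly2 q x y)"

lemma poly_bounded_const: "poly_bounded (\<lambda>x y. k)"
  unfolding poly_bounded_def by (intro exI[of _ "[:[:k:]:]"]) (simp add: poly2_def)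

text \<open>\<open>poly2\<close> substitutes the first argument for the outer variable and the
  second for the inner one.\<close>

lemma poly_bounded_fst: "poly_bounded (\<lambda>x y. x)"
  unfolding poly_bounded_def by (intro exI[of _ "[:0, 1:]"]) (simp add: poly2_def)

lemma poly_bounded_snd: "poly_bounded (\<lambda>x y. y)"
  unfolding poly_bounded_def by (intro exI[of _ "[:[:0, 1:]:]"]) (simp add: poly2_def)

lemma poly_bounded_add:
  assumes "poly_bounded f" "poly_bounded g"
  shows "poly_bounded (\<lambda>x y. f x y + g x y)"
proof -
  obtain q r where "f x y \<le> poly2 q x y" "g x y \<le> poly2 r x y" for x y
    using assms unfolding poly_bounded_def by blast
  then have "f x y + g x y \<le> poly2 (q + r) x y" for x y
    by (simp add: poly2_def add_mono)
  then show ?thesis unfolding poly_bounded_def by blast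
qed

lemma poly_bounded_mult:
  assumes "poly_bounded f" "poly_bounded g"
  shows "poly_bounded (\<lambda>x y. f x y * g x y)"
proof -
  obtain q r where "f x y \<le> poly2 q x y" "g x y \<le> poly2 r x y" for x y
    using assms unfolding poly_bounded_def by blast
  then have "f x y * g x y \<le> poly2 (q * r) x y" for x y
    by (simp add: poly2_def mult_mono)
  then show ?thesis unfolding poly_bounded_def by blast
qed

lemmas poly_bounded_intros =
  poly_bounded_const poly_bounded_fst poly_bounded_snd poly_bounded_add poly_bounded_mult

section \<open>The recurrence\<close>

locale delivery_instance =
  fixes I :: "nat sdsp"
  assumes inst: "sdsp_instance I"
begin

abbreviation "n \<equiv> num I"

text \<open>The width of the table in the profit index: \<open>q < W\<close> covers the profit of
  every set of deliveries.\<close>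

definition W :: nat where
  "W = Suc (total_profit I (deliveries I))"

text \<open>Since \<open>i\<close> is a delivery, it is never 0. This frees 0 for the dummy column
  \<open>j\<close> and for the mark "no predecessor" in \<open>D\<close>.\<close>

definition before :: "nat \<Rightarrow> nat \<Rightarrow> bool" where
  "before i j \<longleftrightarrow> i \<in> deliveries I \<and> (j = 0 \<or> tR I i < tL I j)"

text \<open>A mixed radix number with digits \<open>r\<close>, \<open>j\<close>, \<open>q\<close>:
  addresses are ordered lexicographically, so a single number measures the progress of three nested
  loops.\<close>

definition addr :: "nat \<Rightarrow> nat \<Rightarrow> nat \<Rightarrow> nat" where
  "addr r j q = r * ((n + 1) * W) + (j * W + q)"

text \<open>
  An entry that exceeds the budget stands for infinity. Costs are positive, so it never
  contributes to an entry within the budget.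
\<close>

definition base :: "nat \<Rightarrow> real" where
  "base q = (if q = 0 then 0 else budget I + 1)"

definition extends :: "nat \<Rightarrow> nat \<Rightarrow> nat \<Rightarrow> nat \<Rightarrow> bool" where
  "extends r j q i \<longleftrightarrow> 0 < r \<and> before i j \<and> profit I i \<le> q"

text \<open>Both subtractions are truncated; the value is meaningful under
  \<open>extends\<close>.\<close>

definition ext_cost :: "(nat \<Rightarrow> real) \<Rightarrow> nat \<Rightarrow> nat \<Rightarrow> nat \<Rightarrow> real" where
  "ext_cost G r q i = cost I i + G (addr (r - 1) i (q - profit I i))"

text \<open>A minimum expressed as a lower bound that is attained: the entry is at most the base
  value and every candidate up to \<open>m\<close>, and equals the choice recorded in
  \<open>D\<close>, where 0 marks the base value. The parameter \<open>m\<close> makes this an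
  invariant of the loop over candidates.\<close>

definition cell_ok :: "nat \<Rightarrow> (nat \<Rightarrow> real) \<Rightarrow> (nat \<Rightarrow> nat) \<Rightarrow> nat \<Rightarrow> nat \<Rightarrow> nat \<Rightarrow> bool" where
  "cell_ok m G D r j q \<longleftrightarrow>
     G (addr r j q) \<le> base q \<and>
     (\<forall>i\<le>m. extends r j q i \<longrightarrow> G (addr r j q) \<le> ext_cost G r q i) \<and>
     (D (addr r j q) = 0 \<and> G (addr r j q) = base q \<or>
      extends r j q (D (addr r j q)) \<and> G (addr r j q) = ext_cost G r q (D (addr r j q)))"

definition filled :: "nat \<Rightarrow> (nat \<Rightarrow> real) \<Rightarrow> (nat \<Rightarrow> nat) \<Rightarrow> bool" where
  "filled b G D \<longleftrightarrow> (\<forall>r\<le>n. \<forall>j\<le>n. \<forall>q<W. addr r j q < b \<longrightarrow> cell_ok n G D r j q)"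

lemma finite_deliveries [simp]: "finite (deliveries I)"
  by (simp add: deliveries_def)

lemma budget_pos: "0 < budget I"
  using inst by (simp add: sdsp_instance_def)

lemma cost_pos: "i \<in> deliveries I \<Longrightarrow> 0 < cost I i"
  using inst by (simp add: sdsp_instance_def)

lemma tL_le_tR: "i \<in> deliveries I \<Longrightarrow> tL I i \<le> tR I i"
  using inst by (simp add: sdsp_instance_def)

lemma total_profit_less_W: "S \<subseteq> deliveries I \<Longrightarrow> total_profit I S < W"
  unfolding W_def total_profit_def by (simp add: less_Suc_eq_le sum_mono2)

text \<open>The sum has \<open>n\<close> terms, each at most the maximum. This turns a time bound in
  \<open>W\<close> into a pseudo-polynomial one.\<close>

lemma W_le: "W \<le> 1 + n * max_profit I"
proof -
  have "profit I j \<le> max_profit I" if "j \<in> deliveries I" for j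
    unfolding max_profit_def using that by (intro Max_ge) auto
  then have "total_profit I (deliveries I) \<le> card (deliveries I) * max_profit I"
    unfolding total_profit_def
    using sum_bounded_above[of "deliveries I" "profit I" "max_profit I"] by simp
  then show ?thesis by (simp add: W_def deliveries_def)
qed

lemma addr_next_column: "addr r j W = addr r (Suc j) 0"
  by (simp add: addr_def)

text \<open>As with \<open>addr_next_column\<close>, the address at which an inner loop ends is the
  one at which the next outer round starts.\<close>

lemma addr_next_row: "addr r (Suc n) 0 = addr (Suc r) 0 0"
  by (simp add: addr_def)

lemma addr_less_next_row:
  assumes "j \<le> n" "q < W"
  shows "addr r j q < addr (Suc r) j' q'"
proof -
  have "j * W + q < (j + 1) * W" using assms by simp
  also have "\<dots> \<le> (n + 1) * W" using assms by (intro mult_right_mono) auto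
  finally show ?thesis unfolding addr_def by (simp add: algebra_simps)
qed

text \<open>The digits are read off as remainders, first modulo \<open>W\<close>, then modulo
  \<open>n + 1\<close>.\<close>

lemma addr_inject:
  assumes "addr r j q = addr r' j' q'" "j \<le> n" "j' \<le> n" "q < W" "q' < W"
  shows "r = r' \<and> j = j' \<and> q = q'"
proof -
  have *: "addr r j q = (r * (n + 1) + j) * W + q" for r j q
    by (simp add: addr_def algebra_simps)
  have "q = q'"
    using arg_cong[OF assms(1), of "\<lambda>x. x mod W"] assms(4,5) by (simp add: *)
  with assms(1,4) have eq: "r * (n + 1) + j = r' * (n + 1) + j'"
    by (simp add: *)
  have "j = j'"
    using arg_cong[OF eq, of "\<lambda>x. x mod (n + 1)"] assms(2,3) by (simp del: mult_Suc_right add_Suc_right add: less_Suc_eq_le)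
  with eq have "r * (n + 1) = r' * (n + 1)" by linarith
  with \<open>q = q'\<close> \<open>j = j'\<close> show ?thesis
    by (simp del: mult_Suc_right add: mult_cancel2)
qed

section \<open>Dependencies between entries and progress of the filling\<close>

lemma before_le: "before i j \<Longrightarrow> i \<le> n"
  by (simp add: before_def deliveries_def)

text \<open>The recurrence refers to the preceding row only, so filling by increasing address
  respects all dependencies, whatever the order of the deliveries.\<close>

lemma ext_addr_less:
  assumes "extends r j q i" "q < W"
  shows "addr (r - 1) i (q - profit I i) < addr r j q"
proof -
  obtain r' where "r = Suc r'"
    using assms by (auto simp: extends_def gr0_conv_Suc)
  then show ?thesis
    using assms addr_less_next_row[of i "q - profit I i" r'] before_le[of i j]
    by (auto simp: extends_def)
qed

text \<open>A cell depends on itself and, by \<open>ext_addr_less\<close>, on smaller addresses;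
  later writes do not invalidate it.\<close>

lemma cell_ok_cong:
  assumes "q < W" "addr r j q < b" "\<And>a. a < b \<Longrightarrow> G' a = G a" "\<And>a. a < b \<Longrightarrow> D' a = D a"
  shows "cell_ok m G' D' r j q \<longleftrightarrow> cell_ok m G D r j q"
proof -
  have "ext_cost G' r q i = ext_cost G r q i" if "extends r j q i" for i
    unfolding ext_cost_def using ext_addr_less[OF that assms(1)] assms by auto
  with assms(2-4) show ?thesis unfolding cell_ok_def by auto
qed

text \<open>0 is not a delivery, so there is no candidate up to 0.\<close>

lemma cell_ok_0:
  "q < W \<Longrightarrow> cell_ok 0 (G(addr r j q := base q)) (D(addr r j q := 0)) r j q"
  by (auto simp: cell_ok_def extends_def before_def deliveries_def)

lemma cell_ok_Suc_keep:
  assumes "cell_ok m G D r j q"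
    "extends r j q (Suc m) \<Longrightarrow> G (addr r j q) \<le> ext_cost G r q (Suc m)"
  shows "cell_ok (Suc m) G D r j q"
  using assms unfolding cell_ok_def by (auto simp: le_Suc_eq)

text \<open>The new value is below the old one, so the old inequalities persist; the write does not
  change candidate costs, which are read at smaller addresses.\<close>

lemma cell_ok_Suc_improve:
  assumes ok: "cell_ok m G D r j q" and q: "q < W"
    and ext: "extends r j q (Suc m)" and less: "ext_cost G r q (Suc m) < G (addr r j q)"
  shows "cell_ok (Suc m) (G(addr r j q := ext_cost G r q (Suc m))) (D(addr r j q := Suc m)) r j q"
proof -
  let ?G = "G(addr r j q := ext_cost G r q (Suc m))"
  have "ext_cost ?G r q i = ext_cost G r q i" if "extends r j q i" for i
    unfolding ext_cost_def using ext_addr_less[OF that q] by auto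
  then show ?thesis
    using ok ext less unfolding cell_ok_def by (fastforce simp: le_Suc_eq)
qed

lemma filled_update:
  "filled (addr r j q) G D \<Longrightarrow>
   filled (addr r j q) (G(addr r j q := v)) (D(addr r j q := w))"
  unfolding filled_def
  by (intro allI impI, subst cell_ok_cong[where b = "addr r j q" and G = G and D = D]) auto

lemma filled_Suc:
  assumes "filled (addr r j q) G D" "cell_ok n G D r j q" "j \<le> n" "q < W"
  shows "filled (addr r j (Suc q)) G D"
proof -
  have "cell_ok n G D r' j' q'"
    if "r' \<le> n" "j' \<le> n" "q' < W" "addr r' j' q' < addr r j (Suc q)" for r' j' q'
  proof (cases "addr r' j' q' = addr r j q")
    case True
    with addr_inject[OF this] that assms show ?thesis by simp
  next
    case False
    with that(4) have "addr r' j' q' < addr r j q" by (simp add: addr_def)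
    with that assms(1) show ?thesis by (simp add: filled_def)
  qed
  then show ?thesis by (simp add: filled_def)
qed

lemma filledD:
  assumes "filled (addr (Suc n) 0 0) G D" "r \<le> n" "j \<le> n" "q < W"
  shows "cell_ok n G D r j q"
proof -
  have "addr r j q < addr (Suc r) 0 0" using assms by (intro addr_less_next_row)
  also have "\<dots> \<le> addr (Suc n) 0 0"
    unfolding addr_def using assms by (intro add_mono mult_right_mono) auto
  finally show ?thesis using assms unfolding filled_def by blast
qed

section \<open>Comparison of the table with compatible sets\<close>

lemma cell_ok_ext:
  "cell_ok m G D r j q \<Longrightarrow> extends r j q i \<Longrightarrow> i \<le> m \<Longrightarrow> G (addr r j q) \<le> ext_cost G r q i"
  by (simp add: cell_ok_def)

text \<open>Induction on \<open>r\<close>: the delivery of \<open>S\<close> that starts last is the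
  end of the chain, the others lie before it, and the recurrence bounds the entry by the choice of
  this delivery.\<close>

lemma table_le_cost:
  assumes filled: "filled (addr (Suc n) 0 0) G D"
  shows "compatible I S \<Longrightarrow> S \<subseteq> deliveries I \<Longrightarrow> card S \<le> r \<Longrightarrow> r \<le> n \<Longrightarrow> j \<le> n \<Longrightarrow>
    \<forall>i\<in>S. before i j \<Longrightarrow> G (addr r j (total_profit I S)) \<le> total_cost I S"
proof (induction r arbitrary: S j)
  case 0
  then have "S = {}" using finite_subset[of S "deliveries I"] by simp
  moreover have "G (addr 0 j 0) \<le> base 0"
    using filledD[OF filled, of 0 j 0] 0 by (simp add: cell_ok_def W_def)
  ultimately show ?case by (simp add: total_profit_def total_cost_def base_def)
next
  case (Suc r)
  have fin: "finite S" using finite_subset[OF Suc.prems(2)] by simp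
  show ?case
  proof (cases "S = {}")
    case True
    have "G (addr (Suc r) j 0) \<le> base 0"
      using filledD[OF filled, of "Suc r" j 0] Suc.prems by (simp add: cell_ok_def W_def)
    with True show ?thesis by (simp add: total_profit_def total_cost_def base_def)
  next
    case False
    have "Max (tL I ` S) \<in> tL I ` S"
      using fin False by (intro Max_in) auto
    then obtain i where i: "i \<in> S" "tL I i = Max (tL I ` S)"
      by auto
    have max: "tL I k \<le> tL I i" if "k \<in> S" for k
      using fin i(2) that by simp
    let ?T = "S - {i}"
    have "before k i" if "k \<in> ?T" for k
    proof -
      have "interval I k \<inter> interval I i = {}"
        using Suc.prems(1) that i(1) by (auto simp: compatible_def pairwise_def)
      \<comment> \<open>The start of \<open>i\<close> lies outside the interval of \<open>k\<close>
        but not before the start of \<open>k\<close>, hence after its end.\<close>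
      then have "tL I i \<notin> interval I k"
        using tL_le_tR[of i] Suc.prems(2) i(1) by (auto simp: interval_def)
      then show ?thesis
        using that Suc.prems(2) max[of k] by (auto simp: before_def interval_def)
    qed
    moreover have "compatible I ?T"
      using Suc.prems(1) by (auto simp: compatible_def pairwise_def)
    moreover have "i \<le> n" using Suc.prems(2) i(1) by (auto simp: deliveries_def)
    ultimately have IH: "G (addr r i (total_profit I ?T)) \<le> total_cost I ?T"
      using Suc.prems(2-4) i(1) fin by (intro Suc.IH) (auto simp: card_Diff_singleton)
    have profit: "total_profit I S = profit I i + total_profit I ?T"
      unfolding total_profit_def using fin i(1) by (simp add: sum.remove)
    have cost: "total_cost I S = cost I i + total_cost I ?T"
      unfolding total_cost_def using fin i(1) by (simp add: sum.remove)
    have "extends (Suc r) j (total_profit I S) i"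
      using Suc.prems(6) i(1) by (simp add: extends_def profit)
    moreover have "cell_ok n G D (Suc r) j (total_profit I S)"
      by (rule filledD[OF filled Suc.prems(4,5) total_profit_less_W[OF Suc.prems(2)]])
    ultimately have "G (addr (Suc r) j (total_profit I S)) \<le> ext_cost G (Suc r) (total_profit I S) i"
      using \<open>i \<le> n\<close> by (intro cell_ok_ext)
    also have "\<dots> \<le> total_cost I S"
      using IH by (simp add: ext_cost_def profit cost)
    finally show ?thesis .
  qed
qed

text \<open>
  The last conjunct says that whatever may still be added on the left of \<open>j\<close> is
  disjoint from \<open>S\<close>.
\<close>

definition traced :: "(nat \<Rightarrow> real) \<Rightarrow> nat \<Rightarrow> nat set \<Rightarrow> nat \<Rightarrow> nat \<Rightarrow> nat \<Rightarrow> bool" where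
  "traced G Q S r j q \<longleftrightarrow> j \<le> n \<and> q < W \<and> S \<subseteq> deliveries I \<and> compatible I S \<and>
     total_profit I S + q = Q \<and> total_cost I S + G (addr r j q) \<le> budget I \<and>
     (\<forall>i. before i j \<longrightarrow> (\<forall>k\<in>S. tR I i < tL I k))"

section \<open>Recovery of a set from the recorded choices\<close>

lemma total_cost_nonneg: "S \<subseteq> deliveries I \<Longrightarrow> 0 \<le> total_cost I S"
  unfolding total_cost_def by (intro sum_nonneg) (use cost_pos in force)

text \<open>For \<open>q > 0\<close> the base value alone exceeds the budget, and the cost of
  \<open>S\<close> is nonnegative.\<close>

lemma traced_base:
  assumes "traced G Q S r j q" "G (addr r j q) = base q"
  shows "q = 0"
  using assms total_cost_nonneg[of S] unfolding traced_def by (auto simp: base_def split: if_splits)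

text \<open>Entry 0 in \<open>D\<close> ends the chain, but the trace still visits the rows below.
  The entry one row down is at most \<open>base q\<close>, the current entry, so the invariant
  survives.\<close>

lemma traced_stop:
  assumes filled: "filled (addr (Suc n) 0 0) G D" and r: "Suc r \<le> n"
    and tr: "traced G Q S (Suc r) j q" and D: "D (addr (Suc r) j q) = 0"
  shows "traced G Q S r j q"
proof -
  have "cell_ok n G D (Suc r) j q"
    using tr r by (intro filledD[OF filled]) (auto simp: traced_def)
  \<comment> \<open>The other alternative in \<open>cell_ok\<close> would make 0 a delivery.\<close>
  then have *: "G (addr (Suc r) j q) = base q"
    using D by (auto simp: cell_ok_def extends_def before_def deliveries_def)
  with tr have "q = 0" by (rule traced_base)
  moreover have "cell_ok n G D r j q"
    using tr r by (intro filledD[OF filled]) (auto simp: traced_def)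
  ultimately have "G (addr r j q) \<le> G (addr (Suc r) j q)"
    using * by (simp add: cell_ok_def)
  with tr show ?thesis by (simp add: traced_def)
qed

text \<open>The cost of \<open>i\<close> moves from the table entry into the set, and its profit
  from \<open>q\<close> into the set; both sums in \<open>traced\<close> keep their values.\<close>

lemma traced_step:
  assumes filled: "filled (addr (Suc n) 0 0) G D" and r: "Suc r \<le> n"
    and tr: "traced G Q S (Suc r) j q" and D: "D (addr (Suc r) j q) = i" "i \<noteq> 0"
  shows "traced G Q (insert i S) r i (q - profit I i) \<and> i \<in> deliveries I"
proof -
  have "cell_ok n G D (Suc r) j q"
    using tr r by (intro filledD[OF filled]) (auto simp: traced_def)
  then have ext: "extends (Suc r) j q i" and cost: "G (addr (Suc r) j q) = ext_cost G (Suc r) q i"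
    using D by (auto simp: cell_ok_def)
  have i: "i \<in> deliveries I" "before i j" and q: "profit I i \<le> q"
    using ext by (auto simp: extends_def before_def)
  have left: "tR I i < tL I k" if "k \<in> S" for k
    using tr i that by (auto simp: traced_def)
  have "i \<notin> S" using left[of i] tL_le_tR[OF i(1)] by auto
  have "interval I i \<inter> interval I k = {}" if "k \<in> S" for k
    using left[OF that] by (auto simp: interval_def)
  then have "compatible I (insert i S)"
    using tr by (auto simp: traced_def compatible_def pairwise_insert)
  \<comment> \<open>Transitivity: \<open>i'\<close> ends before \<open>i\<close> starts, and
    \<open>i\<close> ends before every element of \<open>S\<close> starts.\<close>
  moreover have "tR I i' < tL I k" if "before i' i" "k \<in> insert i S" for i' k
    using that i left[of k] tL_le_tR[OF i(1)] by (auto simp: before_def deliveries_def)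
  moreover have "finite S" using tr by (auto simp: traced_def intro: finite_subset)
  ultimately show ?thesis
    using tr q i cost \<open>i \<notin> S\<close> before_le[OF i(2)]
    by (auto simp: traced_def total_profit_def total_cost_def ext_cost_def)
qed

text \<open>Row 0 admits no extension, so its entries are base values and no profit is left to
  collect.\<close>

lemma traced_final:
  assumes filled: "filled (addr (Suc n) 0 0) G D" and tr: "traced G Q S 0 j q"
  shows "feasible I S \<and> total_profit I S = Q"
proof -
  have "cell_ok n G D 0 j q"
    using tr by (intro filledD[OF filled]) (auto simp: traced_def)
  then have *: "G (addr 0 j q) = base q"
    by (auto simp: cell_ok_def extends_def)
  with tr have "q = 0" by (rule traced_base)
  with * tr show ?thesis by (simp add: traced_def feasible_def base_def)
qed

section \<open>Optimality\<close>

lemma feasible_table_le: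
  assumes "filled (addr (Suc n) 0 0) G D" "feasible I T"
  shows "G (addr n 0 (total_profit I T)) \<le> budget I"
proof -
  have "card T \<le> card (deliveries I)"
    using assms(2) by (intro card_mono) (auto simp: feasible_def)
  \<comment> \<open>Every delivery lies before the dummy 0, and row \<open>n\<close> allows for all
    cardinalities.\<close>
  then have "G (addr n 0 (total_profit I T)) \<le> total_cost I T"
    using assms(2)
    by (intro table_le_cost[OF assms(1)]) (auto simp: feasible_def before_def deliveries_def)
  with assms(2) show ?thesis by (simp add: feasible_def)
qed

text \<open>The profit of any feasible \<open>T\<close> is itself an index whose entry is within the
  budget, hence at most \<open>Q\<close>.\<close>

lemma optimalI:
  assumes filled: "filled (addr (Suc n) 0 0) G D"
    and max: "\<forall>q<W. G (addr n 0 q) \<le> budget I \<longrightarrow> q \<le> Q"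
    and S: "feasible I S" "total_profit I S = Q"
  shows "optimal I S"
  unfolding optimal_def
proof (intro conjI allI impI)
  fix T
  assume T: "feasible I T"
  then have "total_profit I T < W"
    by (intro total_profit_less_W) (simp add: feasible_def)
  with max feasible_table_le[OF filled T] S(2) show "total_profit I T \<le> total_profit I S"
    by simp
qed (rule S)

section \<open>The program\<close>

text \<open>After the scan, times matter only in comparisons; stating these through
  \<open>before\<close> treats the dummy column 0 like the others.\<close>

definition input_env :: "state \<Rightarrow> bool" where
  "input_env s \<longleftrightarrow> nmem s ''n'' 0 = n \<and> rmem s ''B'' 0 = budget I \<and> nmem s ''W'' 0 = W \<and>
     (\<forall>i\<in>deliveries I. nmem s ''p'' i = profit I i \<and> rmem s ''c'' i = cost I i) \<and>
     (\<forall>i\<in>deliveries I. \<forall>j\<le>n. rmem s ''tR'' i < rmem s ''tL'' j \<longleftrightarrow> before i j)"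

definition env :: "state \<Rightarrow> bool" where
  "env s \<longleftrightarrow> input_env s \<and>
     (\<forall>j\<le>n. nmem s ''C'' j = j * W) \<and> (\<forall>r\<le>n. nmem s ''R'' r = r * ((n + 1) * W))"

lemma input_env_nstore [simp]:
  "''n'' \<noteq> x \<Longrightarrow> ''W'' \<noteq> x \<Longrightarrow> ''p'' \<noteq> x \<Longrightarrow> input_env (nstore x i v s) = input_env s"
  by (simp add: input_env_def)

lemma env_nstore [simp]:
  "''n'' \<noteq> x \<Longrightarrow> ''W'' \<noteq> x \<Longrightarrow> ''p'' \<noteq> x \<Longrightarrow> ''C'' \<noteq> x \<Longrightarrow> ''R'' \<noteq> x \<Longrightarrow>
   env (nstore x i v s) = env s"
  by (simp add: env_def)

lemma env_rstore [simp]: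
  "''B'' \<noteq> x \<Longrightarrow> ''c'' \<noteq> x \<Longrightarrow> ''tL'' \<noteq> x \<Longrightarrow> ''tR'' \<noteq> x \<Longrightarrow>
   env (rstore x i v s) = env s"
  by (simp add: env_def input_env_def)

end

abbreviation cell :: "nexp \<Rightarrow> nexp \<Rightarrow> nexp \<Rightarrow> nexp" where
  "cell r j q \<equiv> NPlus (NCell ''R'' r) (NPlus (NCell ''C'' j) q)"

abbreviation next_i :: nexp where
  "next_i \<equiv> NPlus (V ''i'') (NNum 1)"

text \<open>
  The start of the dummy delivery 0 is the cell 0 of \<open>tL\<close>, which is not part of the input and
  initially 0.
\<close>

definition scan_step :: com where
  "scan_step = Seq (NAssign ''W'' (NNum 0) (NPlus (V ''W'') (NCell ''p'' next_i)))
     (If (RLess (RCell ''tR'' next_i) (RCell ''tL'' (NNum 0))) Skip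
       (RAssign ''tL'' (NNum 0) (RPlus (RCell ''tR'' next_i) (RNum 1))))"

definition scan_input :: com where
  "scan_input = Seq (NAssign ''W'' (NNum 0) (NNum 1)) (For ''i'' (V ''n'') scan_step)"

text \<open>
  The machine has no multiplication. The arrays of multiples provide the products in
  \<^term>\<open>delivery_instance.addr\<close>.
\<close>

definition multiples :: "name \<Rightarrow> nexp \<Rightarrow> com" where
  "multiples x w = For ''i'' (NPlus (V ''n'') (NNum 1))
     (NAssign x next_i (NPlus (NCell x (V ''i'')) w))"

text \<open>The candidate is \<open>i + 1\<close>, as loop counters start at 0. In row 0 the
  truncated \<open>r - 1\<close> stays inside the table, and the first test rejects the
  candidate.\<close>

definition relax :: com where
  "relax =
    (let here = cell (V ''r'') (V ''j'') (V ''q'');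
         new = RPlus (RCell ''c'' next_i)
           (RCell ''G'' (cell (NMinus (V ''r'') (NNum 1)) next_i
             (NMinus (V ''q'') (NCell ''p'' next_i))))
     in If (And (NLess (NNum 0) (V ''r''))
          (And (RLess (RCell ''tR'' next_i) (RCell ''tL'' (V ''j'')))
            (And (Not (NLess (V ''q'') (NCell ''p'' next_i))) (RLess new (RCell ''G'' here)))))
       (Seq (RAssign ''G'' here new) (NAssign ''D'' here next_i)) Skip)"

definition fill_cell :: com where
  "fill_cell =
    (let here = cell (V ''r'') (V ''j'') (V ''q'')
     in Seq (If (NLess (NNum 0) (V ''q''))
              (RAssign ''G'' here (RPlus (RCell ''B'' (NNum 0)) (RNum 1)))
              (RAssign ''G'' here (RNum 0)))
       (Seq (NAssign ''D'' here (NNum 0)) (For ''i'' (V ''n'') relax)))"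

definition fill :: com where
  "fill = For ''r'' (NPlus (V ''n'') (NNum 1))
     (For ''j'' (NPlus (V ''n'') (NNum 1)) (For ''q'' (V ''W'') fill_cell))"

text \<open>Scanning upwards and overwriting leaves the largest admissible \<open>q\<close>.\<close>

definition best_step :: com where
  "best_step =
     If (RLess (RCell ''B'' (NNum 0)) (RCell ''G'' (cell (V ''n'') (NNum 0) (V ''q'')))) Skip
       (NAssign ''x'' (NNum 0) (V ''q''))"

definition find_best :: com where
  "find_best = Seq (NAssign ''x'' (NNum 0) (NNum 0)) (For ''q'' (V ''W'') best_step)"

text \<open>Loops count upwards, so the current row is \<open>n - i\<close>. The cell
  \<open>x\<close>, which handed over the optimum, is reused for the delivery read from
  \<open>D\<close>.\<close>

definition trace_step :: com where
  "trace_step = Seq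
     (NAssign ''x'' (NNum 0)
       (NCell ''D'' (cell (NMinus (V ''n'') (V ''i'')) (V ''j'') (V ''q''))))
     (If (NLess (NNum 0) (V ''x''))
       (Seq (NAssign ''S'' (V ''x'') (NNum 1))
         (Seq (NAssign ''q'' (NNum 0) (NMinus (V ''q'') (NCell ''p'' (V ''x''))))
           (NAssign ''j'' (NNum 0) (V ''x''))))
       Skip)"

definition trace :: com where
  "trace = Seq (NAssign ''q'' (NNum 0) (V ''x'')) (Seq (NAssign ''j'' (NNum 0) (NNum 0))
     (For ''i'' (V ''n'') trace_step))"

definition solve :: com where
  "solve = Seq scan_input (Seq (multiples ''C'' (V ''W''))
     (Seq (multiples ''R'' (NCell ''C'' (NPlus (V ''n'') (NNum 1))))
       (Seq fill (Seq find_best trace))))"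

section \<open>Running time\<close>

definition cell_time :: "nat \<Rightarrow> nat" where
  "cell_time n = for_time n (V ''n'') 200 + 100"

definition row_time :: "nat \<Rightarrow> nat \<Rightarrow> nat" where
  "row_time n w = for_time w (V ''W'') (cell_time n)"

definition layer_time :: "nat \<Rightarrow> nat \<Rightarrow> nat" where
  "layer_time n w = for_time (n + 1) (NPlus (V ''n'') (NNum 1)) (row_time n w)"

definition fill_time :: "nat \<Rightarrow> nat \<Rightarrow> nat" where
  "fill_time n w = for_time (n + 1) (NPlus (V ''n'') (NNum 1)) (layer_time n w)"

definition multiples_time :: "nat \<Rightarrow> nexp \<Rightarrow> nat" where
  "multiples_time n w = for_time (n + 1) (NPlus (V ''n'') (NNum 1)) (ntime w + 100)"

text \<open>Bracketed like the phases of \<open>solve\<close>, to fit \<open>wp_SeqI\<close>. The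
  numerals 100 and 200 are generous bounds for loop-free pieces.\<close>

definition solve_time :: "nat \<Rightarrow> nat \<Rightarrow> nat" where
  "solve_time n w = (for_time n (V ''n'') 100 + 3) +
     (multiples_time n (V ''W'') +
       (multiples_time n (NCell ''C'' (NPlus (V ''n'') (NNum 1))) +
         (fill_time n w + ((for_time w (V ''W'') 100 + 3) + (for_time n (V ''n'') 100 + 100)))))"

lemmas time_defs =
  cell_time_def row_time_def layer_time_def fill_time_def multiples_time_def solve_time_def

lemma solve_time_mono: "w \<le> w' \<Longrightarrow> solve_time n w \<le> solve_time n w'"
  unfolding time_defs by (intro add_mono for_time_mono order.refl)

text \<open>The second argument is the bound from \<open>W_le\<close>; unfolding leaves sums and
  products of \<open>x\<close>, \<open>y\<close> and constants.\<close>

lemma poly_bounded_solve_time: "poly_bounded (\<lambda>x y. solve_time x (1 + x * y))"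
  unfolding time_defs for_time_def by (intro poly_bounded_intros)

section \<open>Correctness of the filling loops\<close>

context delivery_instance
begin

lemma wp_relax:
  assumes s: "env s" "nmem s ''r'' 0 = r" "nmem s ''j'' 0 = j" "nmem s ''q'' 0 = q"
      "nmem s ''i'' 0 = i" and bounds: "r \<le> n" "j \<le> n" "q < W" "i < n"
    and filled: "filled (addr r j q) (rmem s ''G'') (nmem s ''D'')"
    and ok: "cell_ok i (rmem s ''G'') (nmem s ''D'') r j q"
  shows "wp relax (\<lambda>t s'. t \<le> 200 \<and> nmem s' ''i'' 0 = i \<and> env s' \<and> nmem s' ''r'' 0 = r \<and>
    nmem s' ''j'' 0 = j \<and> nmem s' ''q'' 0 = q \<and> nmem s' ''S'' = nmem s ''S'' \<and>
    filled (addr r j q) (rmem s' ''G'') (nmem s' ''D'') \<and>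
    cell_ok (Suc i) (rmem s' ''G'') (nmem s' ''D'') r j q) s"
proof -
  have i: "Suc i \<in> deliveries I" using bounds by (simp add: deliveries_def)
  have here: "nmem s ''R'' r + (nmem s ''C'' j + q) = addr r j q"
    using s(1) bounds by (simp add: env_def input_env_def addr_def)
  have there: "nmem s ''R'' (r - Suc 0) + (nmem s ''C'' (Suc i) + k) = addr (r - 1) (Suc i) k" for k
    using s(1) bounds by (simp add: env_def input_env_def addr_def)
  have vals: "nmem s ''p'' (Suc i) = profit I (Suc i)" "rmem s ''c'' (Suc i) = cost I (Suc i)"
    "rmem s ''tR'' (Suc i) < rmem s ''tL'' j \<longleftrightarrow> before (Suc i) j"
    using s(1) i bounds by (auto simp: env_def input_env_def)
  show ?thesis
  \<comment> \<open>The guard of \<open>relax\<close> expresses exactly this condition.\<close>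
  proof (cases "extends r j q (Suc i) \<and> ext_cost (rmem s ''G'') r q (Suc i) < rmem s ''G'' (addr r j q)")
    case True
    then have "0 < r" "before (Suc i) j" "profit I (Suc i) \<le> q"
      by (auto simp: extends_def)
    with True show ?thesis
      using filled_update[OF filled] cell_ok_Suc_improve[OF ok bounds(3)] s filled
      by (simp add: relax_def Let_def here there vals ext_cost_def del: Nat.add_diff_assoc)
  next
    case False
    then have "cell_ok (Suc i) (rmem s ''G'') (nmem s ''D'') r j q"
      by (intro cell_ok_Suc_keep[OF ok]) auto
    with False show ?thesis
      using s filled
      by (auto simp: relax_def Let_def here there vals ext_cost_def extends_def)
  qed
qed

lemma env_values:
  assumes "env s"
  shows "nmem s ''n'' 0 = n" "nmem s ''W'' 0 = W" "rmem s ''B'' 0 = budget I"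
    "i \<in> deliveries I \<Longrightarrow> nmem s ''p'' i = profit I i"
    "r \<le> n \<Longrightarrow> j \<le> n \<Longrightarrow> nmem s ''R'' r + (nmem s ''C'' j + q) = addr r j q"
    "r \<le> n \<Longrightarrow> j \<le> n \<Longrightarrow> nmem s ''R'' r + nmem s ''C'' j = addr r j 0"
  using assms by (auto simp: env_def input_env_def addr_def)

lemma wp_fill_cell:
  assumes s: "env s" "nmem s ''r'' 0 = r" "nmem s ''j'' 0 = j" "nmem s ''q'' 0 = q"
      "nmem s ''S'' = f" and bounds: "r \<le> n" "j \<le> n" "q < W"
    and filled: "filled (addr r j q) (rmem s ''G'') (nmem s ''D'')"
  shows "wp fill_cell (\<lambda>t s'. t \<le> cell_time n \<and> env s' \<and> nmem s' ''r'' 0 = r \<and>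
    nmem s' ''j'' 0 = j \<and> nmem s' ''q'' 0 = q \<and> nmem s' ''S'' = f \<and>
    filled (addr r j (Suc q)) (rmem s' ''G'') (nmem s' ''D'')) s"
proof -
  \<comment> \<open>Both branches of the test \<open>0 < q\<close> lead to this state, so the loop
    is treated once.\<close>
  define s1 where "s1 = nstore ''D'' (addr r j q) 0 (rstore ''G'' (addr r j q) (base q) s)"
  have loop: "wp (For ''i'' (V ''n'') relax)
    (\<lambda>t s'. t \<le> for_time n (V ''n'') 200 \<and> env s' \<and> nmem s' ''r'' 0 = r \<and>
      nmem s' ''j'' 0 = j \<and> nmem s' ''q'' 0 = q \<and> nmem s' ''S'' = f \<and>
      filled (addr r j (Suc q)) (rmem s' ''G'') (nmem s' ''D'')) s1"
  proof (rule wp_For[where T = 200 and b = n and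
      Inv = "\<lambda>k s'. env s' \<and> nmem s' ''r'' 0 = r \<and>
      nmem s' ''j'' 0 = j \<and> nmem s' ''q'' 0 = q \<and> nmem s' ''S'' = f \<and>
      filled (addr r j q) (rmem s' ''G'') (nmem s' ''D'') \<and>
      cell_ok k (rmem s' ''G'') (nmem s' ''D'') r j q"], goal_cases)
    case 1
    then show ?case
      using s filled_update[OF filled] cell_ok_0[OF bounds(3)] by (simp add: s1_def)
  next
    case (2 k s)
    then show ?case by (simp add: env_values)
  next
    case (3 k s)
    then show ?case
      using bounds by (intro wp_mono[OF wp_relax[of s r j q k]]) auto
  next
    case (4 t s)
    then show ?case using filled_Suc bounds by simp
  qed
  show ?thesis
  proof (cases "0 < q")
    case True
    then show ?thesis
      using s bounds loop
      by (simp add: fill_cell_def Let_def env_values)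
        (auto simp: s1_def base_def cell_time_def add.commute elim!: wp_mono)
  next
    case False
    then show ?thesis
      using s bounds loop
      by (simp add: fill_cell_def Let_def env_values)
        (auto simp: s1_def base_def cell_time_def add.commute elim!: wp_mono)
  qed
qed

lemma wp_fill_row:
  assumes s: "env s" "nmem s ''r'' 0 = r" "nmem s ''j'' 0 = j" "nmem s ''S'' = f"
    and bounds: "r \<le> n" "j \<le> n"
    and filled: "filled (addr r j 0) (rmem s ''G'') (nmem s ''D'')"
  shows "wp (For ''q'' (V ''W'') fill_cell) (\<lambda>t s'. t \<le> row_time n W \<and> env s' \<and>
    nmem s' ''r'' 0 = r \<and> nmem s' ''j'' 0 = j \<and> nmem s' ''S'' = f \<and>
    filled (addr r (Suc j) 0) (rmem s' ''G'') (nmem s' ''D'')) s"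
proof (rule wp_For[where T = "cell_time n" and b = W and
    Inv = "\<lambda>k s'. env s' \<and> nmem s' ''r'' 0 = r \<and> nmem s' ''j'' 0 = j \<and>
      nmem s' ''S'' = f \<and> filled (addr r j k) (rmem s' ''G'') (nmem s' ''D'')"], goal_cases)
  case 1
  then show ?case using s filled by simp
next
  case (2 k s)
  then show ?case by (simp add: env_values)
next
  case (3 k s)
  then show ?case
    using bounds by (intro wp_mono[OF wp_fill_cell[of s r j k]]) auto
next
  case (4 t s)
  then show ?case by (simp add: row_time_def addr_next_column)
qed

lemma wp_fill_layer:
  assumes s: "env s" "nmem s ''r'' 0 = r" "nmem s ''S'' = f" and bounds: "r \<le> n"
    and filled: "filled (addr r 0 0) (rmem s ''G'') (nmem s ''D'')"
  shows "wp (For ''j'' (NPlus (V ''n'') (NNum 1)) (For ''q'' (V ''W'') fill_cell))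
    (\<lambda>t s'. t \<le> layer_time n W \<and> env s' \<and> nmem s' ''r'' 0 = r \<and> nmem s' ''S'' = f \<and>
      filled (addr (Suc r) 0 0) (rmem s' ''G'') (nmem s' ''D'')) s"
proof (rule wp_For[where T = "row_time n W" and b = "n + 1" and
    Inv = "\<lambda>k s'. env s' \<and> nmem s' ''r'' 0 = r \<and>
      nmem s' ''S'' = f \<and> filled (addr r k 0) (rmem s' ''G'') (nmem s' ''D'')"], goal_cases)
  case 1
  then show ?case using s filled by simp
next
  case (2 k s)
  then show ?case by (simp add: env_values)
next
  case (3 k s)
  then show ?case
    using bounds by (intro wp_mono[OF wp_fill_row[of s r k]]) auto
next
  case (4 t s)
  then show ?case using addr_next_row[of r] by (simp add: layer_time_def)
qed

lemma wp_fill: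
  assumes s: "env s" "nmem s ''S'' = f"
  shows "wp fill (\<lambda>t s'. t \<le> fill_time n W \<and> env s' \<and> nmem s' ''S'' = f \<and>
    filled (addr (Suc n) 0 0) (rmem s' ''G'') (nmem s' ''D'')) s"
  unfolding fill_def
proof (rule wp_For[where T = "layer_time n W" and b = "n + 1" and
    Inv = "\<lambda>k s'. env s' \<and> nmem s' ''S'' = f \<and>
      filled (addr k 0 0) (rmem s' ''G'') (nmem s' ''D'')"], goal_cases)
  case 1
  then show ?case using s by (simp add: filled_def addr_def)
next
  case (2 k s)
  then show ?case by (simp add: env_values)
next
  case (3 k s)
  then show ?case
    by (intro wp_mono[OF wp_fill_layer[of s k]]) auto
next
  case (4 t s)
  then show ?case by (simp add: fill_time_def)
qed

section \<open>Correctness of the search and of the trace\<close>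

lemma wp_find_best:
  assumes s: "env s" "nmem s ''S'' = f" "rmem s ''G'' = G" "nmem s ''D'' = D"
    and filled: "filled (addr (Suc n) 0 0) G D"
  shows "wp find_best (\<lambda>t s'. t \<le> for_time W (V ''W'') 100 + 3 \<and> env s' \<and> nmem s' ''S'' = f \<and>
    rmem s' ''G'' = G \<and> nmem s' ''D'' = D \<and> nmem s' ''x'' 0 < W \<and>
    G (addr n 0 (nmem s' ''x'' 0)) \<le> budget I \<and>
    (\<forall>q<W. G (addr n 0 q) \<le> budget I \<longrightarrow> q \<le> nmem s' ''x'' 0)) s"
proof -
  \<comment> \<open>The empty chain makes the initial value 0 of \<open>x\<close>
    admissible.\<close>
  have "G (addr n 0 0) \<le> base 0"
    using filledD[OF filled, of n 0 0] by (simp add: cell_ok_def W_def)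
  then have zero: "G (addr n 0 0) \<le> budget I"
    using budget_pos by (simp add: base_def)
  have W: "0 < W" by (simp add: W_def)
  have loop: "wp (For ''q'' (V ''W'') best_step)
    (\<lambda>t s'. t \<le> for_time W (V ''W'') 100 \<and> env s' \<and> nmem s' ''S'' = f \<and>
      rmem s' ''G'' = G \<and> nmem s' ''D'' = D \<and> nmem s' ''x'' 0 < W \<and>
      G (addr n 0 (nmem s' ''x'' 0)) \<le> budget I \<and>
      (\<forall>q<W. G (addr n 0 q) \<le> budget I \<longrightarrow> q \<le> nmem s' ''x'' 0)) (nstore ''x'' 0 0 s)"
  proof (rule wp_For[where T = 100 and b = W and
      Inv = "\<lambda>k s'. env s' \<and> nmem s' ''S'' = f \<and>
        rmem s' ''G'' = G \<and> nmem s' ''D'' = D \<and> nmem s' ''x'' 0 < W \<and>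
        G (addr n 0 (nmem s' ''x'' 0)) \<le> budget I \<and>
        (\<forall>q<k. G (addr n 0 q) \<le> budget I \<longrightarrow> q \<le> nmem s' ''x'' 0)"], goal_cases)
    case 1
    then show ?case using s zero W by simp
  next
    case (2 k s)
    then show ?case by (simp add: env_values)
  next
    case (3 k s)
    then show ?case
      by (auto simp: best_step_def env_values less_Suc_eq)
  next
    case (4 t s)
    then show ?case by simp
  qed
  then show ?thesis
    by (auto simp: find_best_def elim!: wp_mono)
qed

lemma wp_trace:
  assumes s: "env s" "nmem s ''S'' = (\<lambda>_. 0)" "rmem s ''G'' = G" "nmem s ''D'' = D"
      "nmem s ''x'' 0 = Q"
    and filled: "filled (addr (Suc n) 0 0) G D"
    and Q: "Q < W" "G (addr n 0 Q) \<le> budget I"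
  shows "wp trace (\<lambda>t s'. t \<le> for_time n (V ''n'') 100 + 100 \<and> feasible I (result I s') \<and>
    total_profit I (result I s') = Q) s"
proof -
  have loop: "wp (For ''i'' (V ''n'') trace_step)
    (\<lambda>t s'. t \<le> for_time n (V ''n'') 100 \<and> feasible I (result I s') \<and>
      total_profit I (result I s') = Q) (nstore ''j'' 0 0 (nstore ''q'' 0 Q s))"
  proof (rule wp_For[where T = 100 and b = n and
      Inv = "\<lambda>k s'. env s' \<and> rmem s' ''G'' = G \<and> nmem s' ''D'' = D \<and>
        traced G Q (result I s') (n - k) (nmem s' ''j'' 0) (nmem s' ''q'' 0)"], goal_cases)
    case 1
    then show ?case
      using s Q
      by (simp add: traced_def result_def compatible_def total_profit_def total_cost_def)
  next
    case (2 k s)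
    then show ?case by (simp add: env_values)
  next
    case (3 k s)
    define j q i where "j = nmem s ''j'' 0" and "q = nmem s ''q'' 0"
      and "i = D (addr (Suc (n - Suc k)) j q)"
    have k: "n - k = Suc (n - Suc k)" "Suc (n - Suc k) \<le> n" using 3 by auto
    have tr: "traced G Q (result I s) (Suc (n - Suc k)) j q"
      using 3 k by (simp add: j_def q_def)
    have D: "D (nmem s ''R'' (Suc (n - Suc k)) + (nmem s ''C'' j + q)) = i"
      using 3 k tr by (simp add: env_values traced_def i_def)
    show ?case
    proof (cases "i = 0")
      case True
      then have "traced G Q (result I s) (n - Suc k) j q"
        using traced_stop[OF filled k(2) tr] by (simp add: i_def)
      with True 3 D k show ?thesis
        by (simp add: trace_step_def env_values result_def flip: j_def q_def)
    next
      case False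
      then have *: "traced G Q (insert i (result I s)) (n - Suc k) i (q - profit I i)"
        "i \<in> deliveries I"
        using traced_step[OF filled k(2) tr] by (auto simp: i_def)
      \<comment> \<open>Membership after cell \<open>i\<close> of \<open>S\<close> has been set to
        1: the case \<open>l = i\<close> passes, since \<open>i\<close> is a delivery.\<close>
      moreover have "{l. l \<noteq> i \<longrightarrow> l \<in> deliveries I \<and> 0 < nmem s ''S'' l} = insert i (result I s)"
        using * by (auto simp: result_def)
      ultimately show ?thesis
        using False 3 D k
        by (simp add: trace_step_def env_values result_def flip: j_def q_def)
    qed
  next
    case (4 t s)
    then show ?case using traced_final[OF filled, of Q "result I s"] by auto
  qed
  then show ?thesis
    using s by (auto simp: trace_def elim!: wp_mono)
qed

section \<open>Preprocessing of the input\<close>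

lemma wp_multiples:
  assumes "P s" "nmem s x 0 = 0" "x \<noteq> ''i''"
    and keep: "\<And>s i v. P s \<Longrightarrow> P (nstore x (Suc i) v s)" "\<And>s v. P s \<Longrightarrow> P (nstore ''i'' 0 v s)"
    and vals: "\<And>s. P s \<Longrightarrow> nmem s ''n'' 0 = n" "\<And>s. P s \<Longrightarrow> nval w s = m"
  shows "wp (multiples x w) (\<lambda>t s'.
    t \<le> multiples_time n w \<and> P s' \<and>
    (\<forall>j\<le>Suc n. nmem s' x j = j * m)) s"
  unfolding multiples_def
proof (rule wp_For[where T = "ntime w + 100" and b = "n + 1" and
    Inv = "\<lambda>k s. P s \<and> (\<forall>j\<le>k. nmem s x j = j * m)"], goal_cases)
  case 1
  then show ?case using assms by simp
next
  case (2 k s)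
  then show ?case using vals by simp
next
  case (3 k s)
  then show ?case using assms(3) keep vals by (auto simp: le_Suc_eq)
next
  case (4 t s)
  then show ?case by (simp add: multiples_time_def)
qed

lemma wp_scan_input:
  "wp scan_input (\<lambda>t s. t \<le> for_time n (V ''n'') 100 + 3 \<and> input_env s \<and>
     nmem s ''S'' = (\<lambda>_. 0) \<and> nmem s ''C'' 0 = 0 \<and> nmem s ''R'' 0 = 0) (load I)"
proof -
  have "wp (For ''i'' (V ''n'') scan_step) (\<lambda>t s. t \<le> for_time n (V ''n'') 100 \<and> input_env s \<and>
     nmem s ''S'' = (\<lambda>_. 0) \<and> nmem s ''C'' 0 = 0 \<and> nmem s ''R'' 0 = 0) (nstore ''W'' 0 1 (load I))"
  proof (rule wp_For[where T = 100 and b = n and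
    Inv = "\<lambda>k s. nmem s ''n'' 0 = n \<and> rmem s ''B'' 0 = budget I \<and>
      nmem s ''W'' 0 = Suc (sum (profit I) {1..k}) \<and>
      (\<forall>i\<in>deliveries I. nmem s ''p'' i = profit I i \<and> rmem s ''c'' i = cost I i \<and>
        rmem s ''tR'' i = tR I i \<and> rmem s ''tL'' i = tL I i) \<and>
      (\<forall>i\<in>{1..k}. tR I i < rmem s ''tL'' 0) \<and>
      nmem s ''S'' = (\<lambda>_. 0) \<and> nmem s ''C'' 0 = 0 \<and> nmem s ''R'' 0 = 0"], goal_cases)
    case 1
    show ?case by (simp add: load_def)
  next
    case (2 k s)
    then show ?case by simp
  next
    case (3 k s)
    then have k: "Suc k \<in> deliveries I" by (simp add: deliveries_def)
    \<comment> \<open>Writing cell 0 of \<open>tL\<close> thus affects no input. The cell is only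
      ever raised, so ends scanned earlier stay to its left.\<close>
    have "0 \<notin> deliveries I" by (simp add: deliveries_def)
    with 3 k show ?case
      by (auto simp: scan_step_def atLeastAtMostSuc_conv)
  next
    case (4 t s)
    have "rmem s ''tR'' i < rmem s ''tL'' j \<longleftrightarrow> before i j"
      if "i \<in> deliveries I" "j \<le> n" for i j
      using that 4 by (cases "j = 0") (auto simp: before_def deliveries_def)
    with 4 show ?case
      by (simp add: input_env_def W_def total_profit_def deliveries_def)
  qed
  then show ?thesis
    by (auto simp: scan_input_def elim!: wp_mono)
qed

section \<open>The whole algorithm\<close>

lemma wp_solve: "wp solve (\<lambda>t s. t \<le> solve_time n W \<and> optimal I (result I s)) (load I)"
  unfolding solve_def solve_time_def
proof (rule wp_SeqI[OF wp_scan_input], elim conjE, goal_cases)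
  case (1 s)
  have C: "wp (multiples ''C'' (V ''W'')) (\<lambda>t s'. t \<le> multiples_time n (V ''W'') \<and>
      (input_env s' \<and> nmem s' ''S'' = (\<lambda>_. 0) \<and> nmem s' ''R'' 0 = 0) \<and>
      (\<forall>j\<le>Suc n. nmem s' ''C'' j = j * W)) s"
    using 1 by (intro wp_multiples[where P = "\<lambda>s. input_env s \<and> nmem s ''S'' = (\<lambda>_. 0) \<and>
      nmem s ''R'' 0 = 0"]) (simp_all add: input_env_def)
  show ?case
  proof (rule wp_SeqI[OF C], goal_cases)
    case (1 s)
    \<comment> \<open>Entry \<open>n + 1\<close> of \<open>C\<close>, due to the extra round in
      \<open>multiples\<close>, is the size \<open>(n + 1) * W\<close> of a row.\<close>
    have R: "wp (multiples ''R'' (NCell ''C'' (NPlus (V ''n'') (NNum 1))))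
      (\<lambda>t s'. t \<le> multiples_time n (NCell ''C'' (NPlus (V ''n'') (NNum 1))) \<and>
        (input_env s' \<and> nmem s' ''S'' = (\<lambda>_. 0) \<and> (\<forall>j\<le>Suc n. nmem s' ''C'' j = j * W)) \<and>
        (\<forall>j\<le>Suc n. nmem s' ''R'' j = j * ((n + 1) * W))) s"
      using 1 by (intro wp_multiples[where P = "\<lambda>s. input_env s \<and> nmem s ''S'' = (\<lambda>_. 0) \<and>
        (\<forall>j\<le>Suc n. nmem s ''C'' j = j * W)"]) (simp_all add: input_env_def)
    show ?case
    proof (rule wp_SeqI[OF R], goal_cases)
      case (1 s)
      then have s: "env s" "nmem s ''S'' = (\<lambda>_. 0)" by (auto simp: env_def)
      show ?case
      proof (rule wp_SeqI[OF wp_fill[OF s]], elim conjE, goal_cases)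
        case (1 s)
        note filled = \<open>filled (addr (Suc n) 0 0) (rmem s ''G'') (nmem s ''D'')\<close>
        show ?case
        proof (rule wp_SeqI[OF wp_find_best[OF 1(1,2) refl refl filled]], elim conjE, goal_cases)
          case (1 s')
          note max = 1(7)
          show ?case
          proof (rule wp_mono[OF wp_trace[OF 1(1-4) refl filled 1(5,6)]], elim conjE, goal_cases)
            case (1 t s'')
            show ?case
              by (rule conjI[OF 1(1) optimalI[OF filled max 1(2,3)]])
          qed
        qed
      qed
    qed
  qed
qed

end

theorem theorem1:
  "\<exists>(alg :: com) (q :: nat poly poly). \<forall>I :: nat sdsp. sdsp_instance I \<longrightarrow>
     (\<exists>t s. exec alg (load I) t s \<and> optimal I (result I s) \<and>
            t \<le> poly2 q (num I) (max_profit I))"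
proof -
  \<comment> \<open>The polynomial is fixed before any instance.\<close>
  obtain q where q: "solve_time x (1 + x * y) \<le> poly2 q x y" for x y
    using poly_bounded_solve_time unfolding poly_bounded_def by blast
  have "\<exists>t s. exec solve (load I) t s \<and> optimal I (result I s) \<and>
    t \<le> poly2 q (num I) (max_profit I)" if "sdsp_instance I" for I :: "nat sdsp"
  proof -
    interpret delivery_instance I by unfold_locales (rule that)
    obtain t s where ts: "exec solve (load I) t s" "t \<le> solve_time n W" "optimal I (result I s)"
      using wp_solve unfolding wp_def by blast
    have "t \<le> poly2 q n (max_profit I)"
      using ts(2) solve_time_mono[OF W_le] q by (meson order.trans)
    with ts show ?thesis by blast
  qed
  then show ?thesis by blast
qed

end
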